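(* Let $\Gamma$ be a finite group and let $k$ be a positive integer. Then every directed $\Gamma$-labelled graph $(\vec G,\gamma)$ with $A\subseteq V(G)$ has either $k$ pairwise vertex-disjoint $\Gamma$-zero $A$-paths, or a vertex set $X\subseteq V(G)$ with $|X|<6(k-1)|\Gamma|$ such that $(\vec G-X,\gamma)$ has no $\Gamma$-zero $A$-path.
   Context: Groups are written additively. A directed $\Gamma$-labelled graph is $(\vec G,\gamma)$ with $\vec G$ an orientation of a finite graph $G$ and $\gamma:E(G)\to\Gamma$; the weight of a walk $v_0e_1v_1\dots e_mv_m$ is $\gamma(e_1,v_1)+\dots+\gamma(e_m,v_m)$, where for $e$ oriented from $u$ to $v$, $\gamma(e,v)=\gamma(e)$ and $\gamma(e,u)=-\gamma(e)$; a path is $\Gamma$-zero if its weight is $0$. An $A$-path is a path with at least one edge meeting $A$ exactly in its endpoints.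
   Formalization: For k = 1 the bound |X| < 6(k−1)|Γ| = 0 cannot hold (the empty graph is a counterexample), so the formal statement also allows the alternative k = 1 and X = ∅; for k ≥ 2 it is as stated. *)

theory Defs
  imports "Graph_Theory.Digraph_Component" "HOL-Library.Cardinality"
begin

text \<open>
  The oriented graph is a \<open>pre_digraph\<close>: the edges of the underlying undirected graph are its arcs,
  and \<open>tail\<close>, \<open>head\<close> give the orientation. Parallel (also antiparallel) arcs are parallel edges of
  the underlying graph. A walk \<open>v\<^sub>0 e\<^sub>1 v\<^sub>1 \<dots> e\<^sub>m v\<^sub>m\<close> of the underlying graph, which may traverse arcs
  in either direction, is represented by the pair \<open>(v\<^sub>0, [(e\<^sub>1, v\<^sub>1), \<dots>, (e\<^sub>m, v\<^sub>m)])\<close>.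
\<close>

type_synonym ('a, 'b) gwalk = "'a \<times> ('b \<times> 'a) list"

fun steps_from :: "('a, 'b) pre_digraph \<Rightarrow> 'a \<Rightarrow> ('b \<times> 'a) list \<Rightarrow> bool" where
  "steps_from G u [] \<longleftrightarrow> u \<in> verts G"
| "steps_from G u ((e, v) # p) \<longleftrightarrow>
     u \<in> verts G \<and> e \<in> arcs G \<and>
     (tail G e = u \<and> head G e = v \<or> tail G e = v \<and> head G e = u) \<and>
     steps_from G v p"

definition is_gwalk :: "('a, 'b) pre_digraph \<Rightarrow> ('a, 'b) gwalk \<Rightarrow> bool" where
  "is_gwalk G W \<longleftrightarrow> steps_from G (fst W) (snd W)"

definition gwalk_verts :: "('a, 'b) gwalk \<Rightarrow> 'a list" where
  "gwalk_verts W = fst W # map snd (snd W)"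

definition is_gpath :: "('a, 'b) pre_digraph \<Rightarrow> ('a, 'b) gwalk \<Rightarrow> bool" where
  "is_gpath G P \<longleftrightarrow> is_gwalk G P \<and> distinct (gwalk_verts P)"

text \<open>The label \<open>\<gamma>(e, v)\<close> of traversing \<open>e\<close> towards its end \<open>v\<close>; only meaningful if \<open>e\<close> is not a loop.\<close>

definition dir_label ::
    "('a, 'b) pre_digraph \<Rightarrow> ('b \<Rightarrow> 'g::group_add) \<Rightarrow> 'b \<Rightarrow> 'a \<Rightarrow> 'g" where
  "dir_label G \<gamma> e v = (if v = head G e then \<gamma> e else - \<gamma> e)"

text \<open>The group need not be abelian; \<open>sum_list\<close> adds the labels in the order of the walk.\<close>

definition gwalk_weight ::
    "('a, 'b) pre_digraph \<Rightarrow> ('b \<Rightarrow> 'g::group_add) \<Rightarrow> ('a, 'b) gwalk \<Rightarrow> 'g" where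
  "gwalk_weight G \<gamma> W = (\<Sum>(e, v)\<leftarrow>snd W. dir_label G \<gamma> e v)"

definition is_A_path :: "('a, 'b) pre_digraph \<Rightarrow> 'a set \<Rightarrow> ('a, 'b) gwalk \<Rightarrow> bool" where
  "is_A_path G A P \<longleftrightarrow> is_gpath G P \<and> snd P \<noteq> [] \<and>
     set (gwalk_verts P) \<inter> A = {hd (gwalk_verts P), last (gwalk_verts P)}"

definition is_zero_A_path ::
    "('a, 'b) pre_digraph \<Rightarrow> ('b \<Rightarrow> 'g::group_add) \<Rightarrow> 'a set \<Rightarrow> ('a, 'b) gwalk \<Rightarrow> bool" where
  "is_zero_A_path G \<gamma> A P \<longleftrightarrow> is_A_path G A P \<and> gwalk_weight G \<gamma> P = 0"

definition del_verts :: "('a, 'b) pre_digraph \<Rightarrow> 'a set \<Rightarrow> ('a, 'b) pre_digraph" where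
  "del_verts G X = G \<restriction> (verts G - X)"

end

theory Submission
  imports Defs "HOL-Library.Disjoint_Sets"
begin

text \<open>
  Consider vertex-disjoint subcubic trees in \<open>G\<close>, each containing a \<open>\<Gamma>\<close>-zero \<open>A\<close>-path, whose leaves
  are precisely their vertices in \<open>A\<close>, and choose such a family with as many leaves as possible.
  A \<open>\<Gamma>\<close>-zero \<open>A\<close>-path avoiding the set \<open>X\<close> of all leaves and branch vertices would either be disjoint
  from all trees, and could be added as a new tree, or its initial segment up to the first tree vertex
  could be added as a new branch; both contradict maximality.

  Put \<open>n = |\<Gamma>|\<close>. Whenever two leaves below a vertex \<open>v\<close> have paths to \<open>v\<close> of the same weight, the path
  between them has weight zero. Splitting off such paths greedily from the leaves towards the root,
  we discard at most \<open>2n\<close> leaves for every path found, so a tree with \<open>l\<close> leaves contains \<open>p \<ge> 1\<close>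
  disjoint \<open>\<Gamma>\<close>-zero \<open>A\<close>-paths with \<open>l \<le> 3np\<close>. As such a tree has \<open>2l - 2\<close> leaves and branch vertices,
  fewer than \<open>k\<close> paths in total mean \<open>|X| < 6(k - 1)n\<close>.
\<close>

section \<open>Walks in the underlying graph: concatenation and reversal\<close>

definition joins :: "('a, 'b) pre_digraph \<Rightarrow> 'b \<Rightarrow> 'a \<Rightarrow> 'a \<Rightarrow> bool" where
  "joins G e u v \<longleftrightarrow>
     e \<in> arcs G \<and> (tail G e = u \<and> head G e = v \<or> tail G e = v \<and> head G e = u)"

lemma joins_sym: "joins G e u v \<longleftrightarrow> joins G e v u"
  by (auto simp: joins_def)

lemma steps_from_Cons:
  "steps_from G u ((e, v) # p) \<longleftrightarrow> u \<in> verts G \<and> joins G e u v \<and> steps_from G v p"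
  by (auto simp: joins_def)

lemma dir_label_reverse:
  assumes "joins G e u v" "u \<noteq> v"
  shows "dir_label G \<gamma> e u = - dir_label G \<gamma> e v"
  using assms by (auto simp: joins_def dir_label_def)

lemma steps_from_append:
  "steps_from G u (p @ q) \<longleftrightarrow>
     steps_from G u p \<and> steps_from G (last (gwalk_verts (u, p))) q"
proof (induction G u p rule: steps_from.induct)
  case (1 G u)
  then show ?case by (cases q) (auto simp: gwalk_verts_def)
qed (auto simp: gwalk_verts_def)

lemma set_gwalk_verts_subset: "is_gwalk G (u, p) \<Longrightarrow> set (gwalk_verts (u, p)) \<subseteq> verts G"
  unfolding is_gwalk_def fst_conv snd_conv
  by (induction G u p rule: steps_from.induct) (auto simp: gwalk_verts_def)

lemma gwalk_verts_Cons [simp]: "gwalk_verts (u, (e, v) # p) = u # gwalk_verts (v, p)"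
  by (simp add: gwalk_verts_def)

lemma gwalk_verts_not_Nil [simp]: "gwalk_verts P \<noteq> []"
  by (simp add: gwalk_verts_def)

lemma gwalk_verts_append: "gwalk_verts (u, p @ q) = gwalk_verts (u, p) @ map snd q"
  by (simp add: gwalk_verts_def)

lemma gwalk_weight_Cons:
  "gwalk_weight G \<gamma> (u, (e, v) # p) = dir_label G \<gamma> e v + gwalk_weight G \<gamma> (v, p)"
  by (simp add: gwalk_weight_def)

text \<open>The weight reads only the steps, so the start vertex \<open>w\<close> of the second part
  is arbitrary.\<close>

lemma gwalk_weight_append:
  "gwalk_weight G \<gamma> (u, p @ q) = gwalk_weight G \<gamma> (u, p) + gwalk_weight G \<gamma> (w, q)"
  by (simp add: gwalk_weight_def)

text \<open>Negating a sum in a possibly nonabelian group reverses its order, and this is the order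
  of the reversed steps. The step list cannot just be reversed, as each edge must be paired with its
  other end; hence the existential form.\<close>

lemma is_gpath_reverse:
  fixes \<gamma> :: "'b \<Rightarrow> 'g::group_add"
  assumes "is_gpath G (u, p)"
  shows "\<exists>w q. is_gpath G (w, q) \<and> gwalk_verts (w, q) = rev (gwalk_verts (u, p)) \<and>
    gwalk_weight G \<gamma> (w, q) = - gwalk_weight G \<gamma> (u, p)"
  using assms
proof (induction p arbitrary: u)
  case Nil
  then show ?case
    by (intro exI[of _ u] exI[of _ "[]"]) (simp add: gwalk_verts_def gwalk_weight_def)
next
  case (Cons s p)
  obtain e v where s: "s = (e, v)" by force
  have st: "u \<in> verts G" "joins G e u v" "is_gpath G (v, p)" "u \<notin> set (gwalk_verts (v, p))"
    using Cons.prems unfolding s is_gpath_def is_gwalk_def fst_conv snd_conv steps_from_Cons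
    by auto
  obtain w q where q: "is_gpath G (w, q)" "gwalk_verts (w, q) = rev (gwalk_verts (v, p))"
    "gwalk_weight G \<gamma> (w, q) = - gwalk_weight G \<gamma> (v, p)"
    using Cons.IH[OF st(3)] by blast
  have last: "last (gwalk_verts (w, q)) = v"
    unfolding q(2) by (simp add: gwalk_verts_def)
  \<comment> \<open>On a loop both traversals get the same \<open>dir_label\<close>, so the ends
    must differ.\<close>
  have neq: "u \<noteq> v" using st(4) by (auto simp: gwalk_verts_def)
  have verts: "gwalk_verts (w, q @ [(e, u)]) = rev (gwalk_verts (u, s # p))"
    using q(2) by (simp add: s gwalk_verts_append)
  have "steps_from G w (q @ [(e, u)])"
    using q(1) st(1,2) last set_gwalk_verts_subset[of G v p] st(3)
    unfolding steps_from_append steps_from_Cons is_gpath_def is_gwalk_def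
    by (auto simp: joins_sym gwalk_verts_def)
  moreover have "distinct (gwalk_verts (w, q @ [(e, u)]))"
    using Cons.prems unfolding verts is_gpath_def by simp
  moreover have "gwalk_weight G \<gamma> (w, q @ [(e, u)]) = - gwalk_weight G \<gamma> (u, s # p)"
    using dir_label_reverse[OF st(2) neq, of \<gamma>] q(3)
    by (simp add: s gwalk_weight_def minus_add)
  ultimately show ?case
    using verts unfolding is_gpath_def is_gwalk_def by (metis fst_conv snd_conv)
qed

section \<open>Weights of paths from a vertex to \<open>A\<close>, and gluing them to zero
  \<open>A\<close>-paths\<close>

text \<open>The region \<open>R\<close> confines the path, so that paths from different subtrees are
  disjoint. For \<open>v\<close> in \<open>A\<close> only the trivial path qualifies.\<close>

definition reaches_with_weight ::
    "('a, 'b) pre_digraph \<Rightarrow> ('b \<Rightarrow> 'g::group_add) \<Rightarrow> 'a set \<Rightarrow> 'a set \<Rightarrow> 'a \<Rightarrow> 'g \<Rightarrow> bool" where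
  "reaches_with_weight G \<gamma> A R v g \<longleftrightarrow>
     (\<exists>p. is_gpath G (v, p) \<and> set (gwalk_verts (v, p)) \<subseteq> R \<and>
        set (gwalk_verts (v, p)) \<inter> A = {last (gwalk_verts (v, p))} \<and> gwalk_weight G \<gamma> (v, p) = g)"

lemma reaches_with_weight_mono:
  "reaches_with_weight G \<gamma> A R v g \<Longrightarrow> R \<subseteq> R' \<Longrightarrow> reaches_with_weight G \<gamma> A R' v g"
  unfolding reaches_with_weight_def by blast

lemma reaches_with_weight_Cons:
  assumes "reaches_with_weight G \<gamma> A R u g" "joins G e v u" "v \<in> verts G" "v \<notin> A" "v \<notin> R"
  shows "reaches_with_weight G \<gamma> A (insert v R) v (dir_label G \<gamma> e u + g)"
proof -
  obtain p where p: "is_gpath G (u, p)" "set (gwalk_verts (u, p)) \<subseteq> R"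
    "set (gwalk_verts (u, p)) \<inter> A = {last (gwalk_verts (u, p))}" "gwalk_weight G \<gamma> (u, p) = g"
    using assms(1) unfolding reaches_with_weight_def by blast
  show ?thesis
    unfolding reaches_with_weight_def
    using p assms(2-)
    by (intro exI[of _ "(e, u) # p"])
      (auto simp: gwalk_weight_Cons is_gpath_def is_gwalk_def steps_from_Cons
        simp del: steps_from.simps)
qed

text \<open>Reverse one path and continue with the other: the weight is -g + g. The paths share only
  \<open>v\<close>, which is not in \<open>A\<close>, so the result is a path meeting
  \<open>A\<close> just in its two ends.\<close>

lemma zero_A_path_if_same_weight:
  assumes "reaches_with_weight G \<gamma> A (insert v R\<^sub>1) v g"
    and "reaches_with_weight G \<gamma> A (insert v R\<^sub>2) v g"
    and "R\<^sub>1 \<inter> R\<^sub>2 = {}" "v \<notin> R\<^sub>1" "v \<notin> R\<^sub>2" "v \<notin> A"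
  shows "\<exists>P. is_zero_A_path G \<gamma> A P \<and> set (gwalk_verts P) \<subseteq> insert v (R\<^sub>1 \<union> R\<^sub>2)"
proof -
  obtain p where p: "is_gpath G (v, p)" "set (gwalk_verts (v, p)) \<subseteq> insert v R\<^sub>1"
    "set (gwalk_verts (v, p)) \<inter> A = {last (gwalk_verts (v, p))}" "gwalk_weight G \<gamma> (v, p) = g"
    using assms(1) unfolding reaches_with_weight_def by blast
  obtain q where q: "is_gpath G (v, q)" "set (gwalk_verts (v, q)) \<subseteq> insert v R\<^sub>2"
    "set (gwalk_verts (v, q)) \<inter> A = {last (gwalk_verts (v, q))}" "gwalk_weight G \<gamma> (v, q) = g"
    using assms(2) unfolding reaches_with_weight_def by blast
  obtain w r where r: "is_gpath G (w, r)" "gwalk_verts (w, r) = rev (gwalk_verts (v, p))"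
    "gwalk_weight G \<gamma> (w, r) = - g"
    using is_gpath_reverse[OF p(1)] p(4) by blast
  have q_ne: "q \<noteq> []" using q(3) assms(6) by (auto simp: gwalk_verts_def)
  have last_r: "last (gwalk_verts (w, r)) = v"
    unfolding r(2) by (simp add: gwalk_verts_def)
  have vq: "gwalk_verts (v, q) = v # map snd q" by (simp add: gwalk_verts_def)
  have verts: "gwalk_verts (w, r @ q) = rev (gwalk_verts (v, p)) @ map snd q"
    using r(2) by (simp add: gwalk_verts_append)
  have lastq: "last (gwalk_verts (v, q)) = last (gwalk_verts (w, r @ q))"
    using q_ne by (simp add: verts vq)
  have hdp: "last (gwalk_verts (v, p)) = hd (gwalk_verts (w, r @ q))"
    by (simp add: verts hd_rev)
  have "distinct (map snd q)" "v \<notin> set (map snd q)"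
    using q(1) unfolding is_gpath_def vq by auto
  then have "distinct (gwalk_verts (w, r @ q))"
    unfolding verts using p(1,2) q(2) assms(3-5)
    by (auto simp: is_gpath_def vq)
  moreover have "steps_from G w (r @ q)"
    using r(1) q(1) last_r by (simp add: steps_from_append is_gpath_def is_gwalk_def)
  moreover have "set (gwalk_verts (w, r @ q)) \<inter> A =
      {hd (gwalk_verts (w, r @ q)), last (gwalk_verts (w, r @ q))}"
  proof -
    have "set (gwalk_verts (w, r @ q)) = set (gwalk_verts (v, p)) \<union> set (gwalk_verts (v, q))"
      unfolding verts vq by (auto simp: gwalk_verts_def)
    then show ?thesis using p(3) q(3) hdp lastq by (simp add: Int_Un_distrib2 insert_commute)
  qed
  moreover have "gwalk_weight G \<gamma> (w, r @ q) = 0"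
    using r(3) q(4) by (simp add: gwalk_weight_append[where w = v])
  moreover have "set (gwalk_verts (w, r @ q)) \<subseteq> insert v (R\<^sub>1 \<union> R\<^sub>2)"
    unfolding verts using p(2) q(2) by (auto simp: vq)
  ultimately show ?thesis
    using q_ne
    by (intro exI[of _ "(w, r @ q)"])
      (simp add: is_zero_A_path_def is_A_path_def is_gpath_def is_gwalk_def)
qed

text \<open>This serves the leaf from which a rooted tree is hung: its edge to the root is put in
  front of a path from the root to another leaf.\<close>

lemma zero_A_path_if_weight_cancels:
  assumes "reaches_with_weight G \<gamma> A R u g" "joins G e v u" "v \<in> verts G" "v \<in> A" "v \<notin> R"
    and "dir_label G \<gamma> e u + g = 0"
  shows "\<exists>P. is_zero_A_path G \<gamma> A P \<and> set (gwalk_verts P) \<subseteq> insert v R"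
proof -
  obtain p where p: "is_gpath G (u, p)" "set (gwalk_verts (u, p)) \<subseteq> R"
    "set (gwalk_verts (u, p)) \<inter> A = {last (gwalk_verts (u, p))}" "gwalk_weight G \<gamma> (u, p) = g"
    using assms(1) unfolding reaches_with_weight_def by blast
  show ?thesis
    using p assms(2-)
    by (intro exI[of _ "(v, (e, u) # p)"])
      (auto simp: gwalk_weight_Cons is_zero_A_path_def is_A_path_def is_gpath_def is_gwalk_def
        steps_from_Cons simp del: steps_from.simps)
qed

section \<open>Packings of disjoint zero \<open>A\<close>-paths and their unions\<close>

definition zero_packing ::
    "('a, 'b) pre_digraph \<Rightarrow> ('b \<Rightarrow> 'g::group_add) \<Rightarrow> 'a set \<Rightarrow> 'a set \<Rightarrow> ('a, 'b) gwalk set \<Rightarrow> bool"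
  where
  "zero_packing G \<gamma> A U \<P> \<longleftrightarrow> finite \<P> \<and>
     (\<forall>P\<in>\<P>. is_zero_A_path G \<gamma> A P \<and> set (gwalk_verts P) \<subseteq> U) \<and>
     pairwise (\<lambda>P Q. disjnt (set (gwalk_verts P)) (set (gwalk_verts Q))) \<P>"

lemma zero_packing_empty: "zero_packing G \<gamma> A U {}"
  by (simp add: zero_packing_def)

lemma zero_packing_single:
  "is_zero_A_path G \<gamma> A P \<Longrightarrow> set (gwalk_verts P) \<subseteq> U \<Longrightarrow> zero_packing G \<gamma> A U {P}"
  by (simp add: zero_packing_def)

lemma zero_packing_mono: "zero_packing G \<gamma> A U \<P> \<Longrightarrow> U \<subseteq> U' \<Longrightarrow> zero_packing G \<gamma> A U' \<P>"
  unfolding zero_packing_def by blast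

lemma zero_packing_UN:
  assumes "finite I" "disjoint_family_on U I" "\<And>i. i \<in> I \<Longrightarrow> zero_packing G \<gamma> A (U i) (\<P> i)"
  shows "zero_packing G \<gamma> A (\<Union>i\<in>I. U i) (\<Union>i\<in>I. \<P> i)"
    and "card (\<Union>i\<in>I. \<P> i) = (\<Sum>i\<in>I. card (\<P> i))"
proof -
  have disj: "U i \<inter> U j = {}" if "i \<in> I" "j \<in> I" "i \<noteq> j" for i j
    using assms(2) that by (auto simp: disjoint_family_on_def)
  have sub: "set (gwalk_verts P) \<subseteq> U i" if "i \<in> I" "P \<in> \<P> i" for i P
    using assms(3) that by (auto simp: zero_packing_def)
  have "disjnt (set (gwalk_verts P)) (set (gwalk_verts Q))"
    if "i \<in> I" "j \<in> I" "P \<in> \<P> i" "Q \<in> \<P> j" "P \<noteq> Q" for i j P Q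
  proof (cases "i = j")
    case True
    then show ?thesis using assms(3)[of i] that by (auto simp: zero_packing_def pairwise_def)
  next
    case False
    then show ?thesis
      using sub[of i P] sub[of j Q] disj[of i j] that by (auto simp: disjnt_def)
  qed
  then have "pairwise (\<lambda>P Q. disjnt (set (gwalk_verts P)) (set (gwalk_verts Q))) (\<Union>i\<in>I. \<P> i)"
    by (auto simp: pairwise_def)
  moreover have "\<forall>P\<in>\<Union>i\<in>I. \<P> i. is_zero_A_path G \<gamma> A P \<and> set (gwalk_verts P) \<subseteq> (\<Union>i\<in>I. U i)"
    using assms(3) unfolding zero_packing_def by blast
  ultimately show "zero_packing G \<gamma> A (\<Union>i\<in>I. U i) (\<Union>i\<in>I. \<P> i)"
    using assms(1,3) by (auto simp: zero_packing_def)
  have "\<P> i \<inter> \<P> j = {}" if "i \<in> I" "j \<in> I" "i \<noteq> j" for i j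
  proof -
    have False if "P \<in> \<P> i" "P \<in> \<P> j" for P
    proof -
      have "set (gwalk_verts P) \<subseteq> U i \<inter> U j"
        using sub \<open>i \<in> I\<close> \<open>j \<in> I\<close> that by blast
      \<comment> \<open>A walk has at least one vertex, so it cannot lie in two disjoint
        sets.\<close>
      then show False using disj[OF \<open>i \<in> I\<close> \<open>j \<in> I\<close> \<open>i \<noteq> j\<close>] by simp
    qed
    then show ?thesis by blast
  qed
  then show "card (\<Union>i\<in>I. \<P> i) = (\<Sum>i\<in>I. card (\<P> i))"
    using assms(1,3) by (intro card_UN_disjoint) (auto simp: zero_packing_def)
qed

lemma zero_packing_Un:
  assumes "zero_packing G \<gamma> A U \<P>" "zero_packing G \<gamma> A V \<Q>" "U \<inter> V = {}"
  shows "zero_packing G \<gamma> A (U \<union> V) (\<P> \<union> \<Q>)" and "card (\<P> \<union> \<Q>) = card \<P> + card \<Q>"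
proof -
  \<comment> \<open>The union of two packings is treated as a family indexed by
    \<open>bool\<close>.\<close>
  have *: "disjoint_family_on (\<lambda>b. if b then U else V) (UNIV :: bool set)"
    using assms(3) by (auto simp: disjoint_family_on_def)
  have **: "zero_packing G \<gamma> A (if b then U else V) (if b then \<P> else \<Q>)" for b
    using assms by simp
  show "zero_packing G \<gamma> A (U \<union> V) (\<P> \<union> \<Q>)"
    using zero_packing_UN(1)[OF _ * **] by (simp add: UNIV_bool Un_commute)
  show "card (\<P> \<union> \<Q>) = card \<P> + card \<Q>"
    using zero_packing_UN(2)[OF _ * **] by (simp add: UNIV_bool Un_commute)
qed

section \<open>Rooted binary trees with leaves in \<open>A\<close>\<close>

text \<open>
  A rooted tree is recorded by its root \<open>v\<close>, its vertex set \<open>S\<close> and the set \<open>X\<close> of its leaves and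
  branch vertices; since its leaves are its vertices in \<open>A\<close>, their number is \<open>card (S \<inter> A)\<close>.
\<close>

inductive binary_tree ::
    "('a, 'b) pre_digraph \<Rightarrow> 'a set \<Rightarrow> 'a \<Rightarrow> 'a set \<Rightarrow> 'a set \<Rightarrow> bool" for G A where
  leaf: "a \<in> A \<Longrightarrow> a \<in> verts G \<Longrightarrow> binary_tree G A a {a} {a}"
| unary: "binary_tree G A u S X \<Longrightarrow> joins G e v u \<Longrightarrow> v \<in> verts G \<Longrightarrow> v \<notin> A \<Longrightarrow> v \<notin> S \<Longrightarrow>
    binary_tree G A v (insert v S) X"
| binary: "binary_tree G A u\<^sub>1 S\<^sub>1 X\<^sub>1 \<Longrightarrow> joins G e\<^sub>1 v u\<^sub>1 \<Longrightarrow>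
    binary_tree G A u\<^sub>2 S\<^sub>2 X\<^sub>2 \<Longrightarrow> joins G e\<^sub>2 v u\<^sub>2 \<Longrightarrow>
    S\<^sub>1 \<inter> S\<^sub>2 = {} \<Longrightarrow> v \<in> verts G \<Longrightarrow> v \<notin> A \<Longrightarrow> v \<notin> S\<^sub>1 \<Longrightarrow> v \<notin> S\<^sub>2 \<Longrightarrow>
    binary_tree G A v (insert v (S\<^sub>1 \<union> S\<^sub>2)) (insert v (X\<^sub>1 \<union> X\<^sub>2))"

text \<open>The equation says that there is one branch vertex fewer than there are leaves:
  \<open>binary\<close> adds the two counts and creates one new branch vertex.\<close>

lemma binary_tree_basics:
  assumes "binary_tree G A v S X"
  shows "finite S" "S \<subseteq> verts G" "X \<subseteq> S" "S \<inter> A \<subseteq> X" "card X + 1 = 2 * card (S \<inter> A)"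
proof -
  have "finite S \<and> S \<subseteq> verts G \<and> X \<subseteq> S \<and> S \<inter> A \<subseteq> X \<and> card X + 1 = 2 * card (S \<inter> A)"
    using assms
  proof induction
    case (binary u\<^sub>1 S\<^sub>1 X\<^sub>1 e\<^sub>1 v u\<^sub>2 S\<^sub>2 X\<^sub>2 e\<^sub>2)
    have fin: "finite S\<^sub>1" "finite S\<^sub>2" "finite X\<^sub>1" "finite X\<^sub>2"
      using binary.IH by (auto intro: finite_subset)
    have "card (insert v (X\<^sub>1 \<union> X\<^sub>2)) = Suc (card X\<^sub>1 + card X\<^sub>2)"
      using fin binary by (subst card_insert_disjoint) (auto intro!: card_Un_disjoint)
    moreover have "insert v (S\<^sub>1 \<union> S\<^sub>2) \<inter> A = (S\<^sub>1 \<inter> A) \<union> (S\<^sub>2 \<inter> A)"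
      using binary.hyps by blast
    moreover have "card ((S\<^sub>1 \<inter> A) \<union> (S\<^sub>2 \<inter> A)) = card (S\<^sub>1 \<inter> A) + card (S\<^sub>2 \<inter> A)"
      using fin binary.hyps by (intro card_Un_disjoint) auto
    ultimately show ?case using binary fin by auto
  qed auto
  then show "finite S" "S \<subseteq> verts G" "X \<subseteq> S" "S \<inter> A \<subseteq> X" "card X + 1 = 2 * card (S \<inter> A)"
    by auto
qed

text \<open>Every step puts a \<open>unary\<close> vertex on top of the old root, so
  \<open>X\<close> does not change and the end of the path becomes the root.\<close>

lemma binary_tree_add_path:
  assumes "binary_tree G A u S X" "steps_from G u p" "distinct (map snd p)"
    and "set (map snd p) \<inter> (S \<union> A) = {}"
  shows "binary_tree G A (last (gwalk_verts (u, p))) (S \<union> set (map snd p)) X"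
  using assms
proof (induction p arbitrary: u S)
  case Nil
  then show ?case by (simp add: gwalk_verts_def)
next
  case (Cons s p)
  obtain e v where s: "s = (e, v)" by force
  have st: "joins G e v u" "steps_from G v p"
    using Cons.prems(2) unfolding s steps_from_Cons by (auto simp: joins_sym)
  have "v \<in> verts G"
    using set_gwalk_verts_subset[of G v p] st(2) by (auto simp: is_gwalk_def gwalk_verts_def)
  then have "binary_tree G A v (insert v S) X"
    using Cons.prems st by (intro binary_tree.unary[OF Cons.prems(1) st(1)]) (auto simp: s)
  from Cons.IH[OF this st(2)] show ?case
    using Cons.prems by (auto simp: s)
qed

text \<open>Being neither a leaf nor a branch vertex, \<open>w\<close> was created by
  \<open>unary\<close>; replacing this by \<open>binary\<close> attaches the second tree as another
  child.\<close>

lemma binary_tree_graft: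
  assumes "binary_tree G A v S X" "binary_tree G A u T Y" "joins G e w u" "w \<in> S - X" "S \<inter> T = {}"
  shows "\<exists>X'. binary_tree G A v (S \<union> T) X'"
  using assms
proof (induction)
  case (unary u' S X e' v)
  show ?case
  proof (cases "w = v")
    case True
    have "binary_tree G A v (insert v (S \<union> T)) (insert v (X \<union> Y))"
      using unary True by (intro binary_tree.binary[of _ _ u' _ _ e' _ u _ _ e]) auto
    then show ?thesis by auto
  next
    case False
    then obtain X' where "binary_tree G A u' (S \<union> T) X'" using unary by auto
    then have "binary_tree G A v (insert v (S \<union> T)) X'"
      using unary False by (intro binary_tree.unary[of _ _ u' _ _ e']) auto
    then show ?thesis by auto
  qed
next
  case (binary u\<^sub>1 S\<^sub>1 X\<^sub>1 e\<^sub>1 v u\<^sub>2 S\<^sub>2 X\<^sub>2 e\<^sub>2)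
  consider "w \<in> S\<^sub>1 - X\<^sub>1" | "w \<in> S\<^sub>2 - X\<^sub>2"
    using binary.prems by auto
  then show ?case
  proof cases
    case 1
    then obtain X' where "binary_tree G A u\<^sub>1 (S\<^sub>1 \<union> T) X'" using binary by auto
    then have "binary_tree G A v (insert v ((S\<^sub>1 \<union> T) \<union> S\<^sub>2)) (insert v (X' \<union> X\<^sub>2))"
      using binary by (intro binary_tree.binary[of _ _ u\<^sub>1 _ _ e\<^sub>1 _ u\<^sub>2 _ _ e\<^sub>2]) auto
    then show ?thesis by (auto simp: Un_ac)
  next
    case 2
    then obtain X' where "binary_tree G A u\<^sub>2 (S\<^sub>2 \<union> T) X'" using binary by auto
    then have "binary_tree G A v (insert v (S\<^sub>1 \<union> (S\<^sub>2 \<union> T))) (insert v (X\<^sub>1 \<union> X'))"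
      using binary by (intro binary_tree.binary[of _ _ u\<^sub>1 _ _ e\<^sub>1 _ u\<^sub>2 _ _ e\<^sub>2]) auto
    then show ?thesis by (auto simp: Un_ac)
  qed
qed auto

section \<open>Greedy splitting of a rooted tree into zero \<open>A\<close>-paths\<close>

text \<open>
  The greedy step: \<open>R\<close> is what is left of the tree around its root \<open>v\<close> after splitting off the paths
  in \<open>\<P>\<close>, and \<open>W\<close> contains the weights of the paths from \<open>v\<close> to the leaves left in \<open>R\<close>, which
  are pairwise distinct.
\<close>

lemma binary_tree_packing:
  fixes \<gamma> :: "'b \<Rightarrow> 'g::{group_add, finite}"
  assumes "binary_tree G A v S X"
  shows "\<exists>U R \<P> W. U \<union> R \<subseteq> S \<and> U \<inter> R = {} \<and> zero_packing G \<gamma> A U \<P> \<and>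
    (\<forall>g\<in>W. reaches_with_weight G \<gamma> A R v g) \<and>
    card (S \<inter> A) \<le> 2 * CARD('g) * card \<P> + card W"
  using assms
proof induction
  case (leaf a)
  have "reaches_with_weight G \<gamma> A {a} a 0"
    unfolding reaches_with_weight_def using leaf
    by (intro exI[of _ "[]"])
      (simp add: is_gpath_def is_gwalk_def gwalk_verts_def gwalk_weight_def)
  then show ?case
    by (intro exI[of _ "{}"] exI[of _ "{a}"] exI[of _ "{0}"])
      (use leaf in \<open>simp add: zero_packing_empty\<close>)
next
  case (unary u S X e v)
  obtain U R \<P> W where IH: "U \<union> R \<subseteq> S" "U \<inter> R = {}" "zero_packing G \<gamma> A U \<P>"
    "\<forall>g\<in>W. reaches_with_weight G \<gamma> A R u g" "card (S \<inter> A) \<le> 2 * CARD('g) * card \<P> + card W"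
    using unary.IH by blast
  let ?W = "(\<lambda>g. dir_label G \<gamma> e u + g) ` W"
  have "v \<notin> R" using IH(1) unary.hyps by blast
  then have "\<forall>g\<in>?W. reaches_with_weight G \<gamma> A (insert v R) v g"
    using IH(4) unary.hyps reaches_with_weight_Cons[of G \<gamma> A R u _ e v] by blast
  \<comment> \<open>Passing to \<open>v\<close> translates all weights by one group element, so they
    stay distinct.\<close>
  moreover have "card ?W = card W" by (intro card_image) (simp add: inj_on_def)
  moreover have "insert v S \<inter> A = S \<inter> A" using unary.hyps by blast
  ultimately show ?case
    using IH unary.hyps
    by (intro exI[of _ U] exI[of _ "insert v R"] exI[of _ \<P>] exI[of _ ?W]) auto
next
  case (binary u\<^sub>1 S\<^sub>1 X\<^sub>1 e\<^sub>1 v u\<^sub>2 S\<^sub>2 X\<^sub>2 e\<^sub>2)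
  obtain U\<^sub>1 R\<^sub>1 \<P>\<^sub>1 W\<^sub>1 where IH1: "U\<^sub>1 \<union> R\<^sub>1 \<subseteq> S\<^sub>1" "U\<^sub>1 \<inter> R\<^sub>1 = {}" "zero_packing G \<gamma> A U\<^sub>1 \<P>\<^sub>1"
    "\<forall>g\<in>W\<^sub>1. reaches_with_weight G \<gamma> A R\<^sub>1 u\<^sub>1 g"
    "card (S\<^sub>1 \<inter> A) \<le> 2 * CARD('g) * card \<P>\<^sub>1 + card W\<^sub>1"
    using binary.IH(1) by blast
  obtain U\<^sub>2 R\<^sub>2 \<P>\<^sub>2 W\<^sub>2 where IH2: "U\<^sub>2 \<union> R\<^sub>2 \<subseteq> S\<^sub>2" "U\<^sub>2 \<inter> R\<^sub>2 = {}" "zero_packing G \<gamma> A U\<^sub>2 \<P>\<^sub>2"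
    "\<forall>g\<in>W\<^sub>2. reaches_with_weight G \<gamma> A R\<^sub>2 u\<^sub>2 g"
    "card (S\<^sub>2 \<inter> A) \<le> 2 * CARD('g) * card \<P>\<^sub>2 + card W\<^sub>2"
    using binary.IH(2) by blast
  let ?V\<^sub>1 = "(\<lambda>g. dir_label G \<gamma> e\<^sub>1 u\<^sub>1 + g) ` W\<^sub>1"
  let ?V\<^sub>2 = "(\<lambda>g. dir_label G \<gamma> e\<^sub>2 u\<^sub>2 + g) ` W\<^sub>2"
  have v_notin: "v \<notin> R\<^sub>1" "v \<notin> R\<^sub>2" using IH1(1) IH2(1) binary.hyps by blast+
  have r1: "\<forall>g\<in>?V\<^sub>1. reaches_with_weight G \<gamma> A (insert v R\<^sub>1) v g"
    using IH1(4) v_notin binary.hyps reaches_with_weight_Cons[of G \<gamma> A R\<^sub>1 u\<^sub>1 _ e\<^sub>1 v] by blast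
  have r2: "\<forall>g\<in>?V\<^sub>2. reaches_with_weight G \<gamma> A (insert v R\<^sub>2) v g"
    using IH2(4) v_notin binary.hyps reaches_with_weight_Cons[of G \<gamma> A R\<^sub>2 u\<^sub>2 _ e\<^sub>2 v] by blast
  have c: "card ?V\<^sub>1 = card W\<^sub>1" "card ?V\<^sub>2 = card W\<^sub>2"
    by (intro card_image, simp add: inj_on_def)+
  have dU: "U\<^sub>1 \<inter> U\<^sub>2 = {}" using IH1 IH2 binary.hyps by blast
  note P = zero_packing_Un[OF IH1(3) IH2(3) dU]
  have "insert v (S\<^sub>1 \<union> S\<^sub>2) \<inter> A = (S\<^sub>1 \<inter> A) \<union> (S\<^sub>2 \<inter> A)" using binary.hyps by blast
  then have "card (insert v (S\<^sub>1 \<union> S\<^sub>2) \<inter> A) \<le> card (S\<^sub>1 \<inter> A) + card (S\<^sub>2 \<inter> A)"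
    by (simp add: card_Un_le)
  then have card_le: "card (insert v (S\<^sub>1 \<union> S\<^sub>2) \<inter> A) \<le>
      2 * CARD('g) * card (\<P>\<^sub>1 \<union> \<P>\<^sub>2) + (card W\<^sub>1 + card W\<^sub>2)"
    using IH1(5) IH2(5) P(2) by (simp add: distrib_left)
  show ?case
  \<comment> \<open>If no weight occurs on both sides, the two rests are joined at \<open>v\<close>
    and no leaf is lost.\<close>
  proof (cases "?V\<^sub>1 \<inter> ?V\<^sub>2 = {}")
    case True
    have "card (?V\<^sub>1 \<union> ?V\<^sub>2) = card W\<^sub>1 + card W\<^sub>2"
      using True c by (simp add: card_Un_disjoint)
    moreover have "\<forall>g\<in>?V\<^sub>1 \<union> ?V\<^sub>2. reaches_with_weight G \<gamma> A (insert v (R\<^sub>1 \<union> R\<^sub>2)) v g"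
    proof
      fix g assume "g \<in> ?V\<^sub>1 \<union> ?V\<^sub>2"
      then consider "g \<in> ?V\<^sub>1" | "g \<in> ?V\<^sub>2" by blast
      then show "reaches_with_weight G \<gamma> A (insert v (R\<^sub>1 \<union> R\<^sub>2)) v g"
      proof cases
        case 1
        show ?thesis by (rule reaches_with_weight_mono[OF bspec[OF r1 1]]) blast
      next
        case 2
        show ?thesis by (rule reaches_with_weight_mono[OF bspec[OF r2 2]]) blast
      qed
    qed
    moreover have "(U\<^sub>1 \<union> U\<^sub>2) \<inter> insert v (R\<^sub>1 \<union> R\<^sub>2) = {}"
      using IH1(1,2) IH2(1,2) binary.hyps by blast
    moreover have "(U\<^sub>1 \<union> U\<^sub>2) \<union> insert v (R\<^sub>1 \<union> R\<^sub>2) \<subseteq> insert v (S\<^sub>1 \<union> S\<^sub>2)"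
      using IH1(1) IH2(1) by blast
    ultimately show ?thesis
      using P(1) card_le
      by (intro exI[of _ "U\<^sub>1 \<union> U\<^sub>2"] exI[of _ "insert v (R\<^sub>1 \<union> R\<^sub>2)"] exI[of _ "\<P>\<^sub>1 \<union> \<P>\<^sub>2"]
          exI[of _ "?V\<^sub>1 \<union> ?V\<^sub>2"] conjI) simp_all
  next
    case False
    then obtain g where g: "g \<in> ?V\<^sub>1" "g \<in> ?V\<^sub>2" by blast
    have "R\<^sub>1 \<inter> R\<^sub>2 = {}" using IH1(1) IH2(1) binary.hyps by blast
    then obtain P where P': "is_zero_A_path G \<gamma> A P"
      "set (gwalk_verts P) \<subseteq> insert v (R\<^sub>1 \<union> R\<^sub>2)"
      using zero_A_path_if_same_weight[OF bspec[OF r1 g(1)] bspec[OF r2 g(2)]] v_notin \<open>v \<notin> A\<close> by blast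
    have dP: "(U\<^sub>1 \<union> U\<^sub>2) \<inter> insert v (R\<^sub>1 \<union> R\<^sub>2) = {}"
      using IH1(1,2) IH2(1,2) binary.hyps by blast
    note Q = zero_packing_Un[OF P(1) zero_packing_single[OF P'] dP]
    \<comment> \<open>The new path uses up both rests, so the new rest is empty. This loses at most
      \<open>2 * CARD('g)\<close> leaves, which is what one more path pays for.\<close>
    have "card W\<^sub>1 \<le> CARD('g)" "card W\<^sub>2 \<le> CARD('g)" by (simp_all add: card_mono)
    then have "card (insert v (S\<^sub>1 \<union> S\<^sub>2) \<inter> A) \<le> 2 * CARD('g) * card (\<P>\<^sub>1 \<union> \<P>\<^sub>2 \<union> {P})"
      using card_le unfolding Q(2) by simp
    then show ?thesis
      using Q(1) IH1(1) IH2(1)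
      by (intro exI[of _ "(U\<^sub>1 \<union> U\<^sub>2) \<union> insert v (R\<^sub>1 \<union> R\<^sub>2)"] exI[of _ "{}"]
          exI[of _ "\<P>\<^sub>1 \<union> \<P>\<^sub>2 \<union> {P}"] conjI) auto
  qed
qed

section \<open>Unrooted subcubic trees\<close>

text \<open>The tree is hung from one of its leaves, \<open>b\<close>. The edge to \<open>b\<close>
  is the third edge at the root \<open>v\<close> of the binary tree if \<open>v\<close> has two
  children.\<close>

definition frame_tree :: "('a, 'b) pre_digraph \<Rightarrow> 'a set \<Rightarrow> 'a set \<Rightarrow> 'a set \<Rightarrow> bool" where
  "frame_tree G A S X \<longleftrightarrow> (\<exists>b v e S' X'. b \<in> A \<and> b \<in> verts G \<and> b \<notin> S' \<and> joins G e b v \<and>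
     binary_tree G A v S' X' \<and> S = insert b S' \<and> X = insert b X')"

text \<open>Compared with the binary tree, \<open>b\<close> is one more leaf and no branch vertex,
  so there are now two branch vertices fewer than leaves.\<close>

lemma frame_tree_basics:
  assumes "frame_tree G A S X"
  shows "finite S" "S \<subseteq> verts G" "X \<subseteq> S" "S \<inter> A \<subseteq> X" "card X + 2 = 2 * card (S \<inter> A)"
proof -
  obtain b v e S' X' where *: "b \<in> A" "b \<in> verts G" "b \<notin> S'" "joins G e b v"
    "binary_tree G A v S' X'" "S = insert b S'" "X = insert b X'"
    using assms unfolding frame_tree_def by blast
  note B = binary_tree_basics[OF *(5)]
  show "finite S" "S \<subseteq> verts G" "X \<subseteq> S" "S \<inter> A \<subseteq> X" using * B by auto
  have "finite X'" using B finite_subset by blast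
  moreover have "b \<notin> X'" using * B by blast
  ultimately show "card X + 2 = 2 * card (S \<inter> A)" using * B by simp
qed

lemma frame_tree_graft:
  assumes "frame_tree G A S X" "binary_tree G A u T Y" "joins G e w u" "w \<in> S - X" "S \<inter> T = {}"
  shows "\<exists>X'. frame_tree G A (S \<union> T) X'"
proof -
  obtain b v e' S' X' where *: "b \<in> A" "b \<in> verts G" "b \<notin> S'" "joins G e' b v"
    "binary_tree G A v S' X'" "S = insert b S'" "X = insert b X'"
    using assms(1) unfolding frame_tree_def by blast
  \<comment> \<open>Since \<open>b\<close> lies in \<open>X\<close>, the vertex \<open>w\<close> is
    not \<open>b\<close> and belongs to the binary tree.\<close>
  obtain X'' where "binary_tree G A v (S' \<union> T) X''"
    using binary_tree_graft[OF *(5) assms(2,3)] assms(4,5) * by auto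
  then have "frame_tree G A (S \<union> T) (insert b X'')"
    unfolding frame_tree_def using * assms(5)
    by (intro exI[of _ b] exI[of _ v] exI[of _ e'] exI[of _ "S' \<union> T"] exI[of _ X'']) auto
  then show ?thesis by blast
qed

lemma frame_tree_of_A_path:
  assumes "is_A_path G A P"
  shows "\<exists>X. frame_tree G A (set (gwalk_verts P)) X"
proof -
  obtain a p where P: "P = (a, p)" by force
  have A: "steps_from G a p" "distinct (gwalk_verts (a, p))" "p \<noteq> []"
    "set (gwalk_verts (a, p)) \<inter> A = {a, last (gwalk_verts (a, p))}"
    using assms by (auto simp: P is_A_path_def is_gpath_def is_gwalk_def gwalk_verts_def)
  \<comment> \<open>The last vertex is the leaf to hang the tree from; the rest is a binary tree
    with the single leaf \<open>a\<close>.\<close>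
  obtain q e b where p: "p = q @ [(e, b)]"
    using A(3) by (metis rev_exhaust surj_pair)
  have st: "steps_from G a q" "joins G e (last (gwalk_verts (a, q))) b" "b \<in> verts G"
    using A(1) unfolding p steps_from_append steps_from_Cons by auto
  have vs: "gwalk_verts (a, p) = a # map snd q @ [b]" by (simp add: p gwalk_verts_def)
  have "a \<in> verts G" using st(1) by (cases q) auto
  then have leaf: "binary_tree G A a {a} {a}"
    using A(4) by (intro binary_tree.leaf) (auto simp: vs)
  have "set (map snd q) \<inter> ({a} \<union> A) = {}"
    using A(2,4) by (auto simp: vs)
  then have "binary_tree G A (last (gwalk_verts (a, q))) ({a} \<union> set (map snd q)) {a}"
    using A(2) by (intro binary_tree_add_path[OF leaf st(1)]) (auto simp: vs)
  moreover have "b \<in> A" "b \<notin> {a} \<union> set (map snd q)" using A(2,4) by (auto simp: vs)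
  ultimately have "frame_tree G A (insert b ({a} \<union> set (map snd q))) (insert b {a})"
    unfolding frame_tree_def using st(2,3) joins_sym by metis
  moreover have "set (gwalk_verts P) = insert b ({a} \<union> set (map snd q))"
    by (auto simp: P vs)
  ultimately show ?thesis by auto
qed

text \<open>Besides the leaves paid for by the greedy paths, at most \<open>card W\<close> leaves
  and \<open>b\<close> remain. Either \<open>b\<close> and a path with weight in \<open>W\<close>
  yield one more zero path, or \<open>W\<close> misses a group element, which makes up for
  \<open>b\<close>. The given path \<open>P\<close> is the fallback when the greedy step finds
  nothing.\<close>

lemma frame_tree_packing:
  fixes \<gamma> :: "'b \<Rightarrow> 'g::{group_add, finite}"
  assumes "frame_tree G A S X" "is_zero_A_path G \<gamma> A P" "set (gwalk_verts P) \<subseteq> S"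
  shows "\<exists>\<P>. zero_packing G \<gamma> A S \<P> \<and> \<P> \<noteq> {} \<and> card (S \<inter> A) \<le> 3 * CARD('g) * card \<P>"
proof -
  obtain b v e S' X' where *: "b \<in> A" "b \<in> verts G" "b \<notin> S'" "joins G e b v"
    "binary_tree G A v S' X'" "S = insert b S'" "X = insert b X'"
    using assms(1) unfolding frame_tree_def by blast
  obtain U R \<P> W where IH: "U \<union> R \<subseteq> S'" "U \<inter> R = {}" "zero_packing G \<gamma> A U \<P>"
    "\<forall>g\<in>W. reaches_with_weight G \<gamma> A R v g" "card (S' \<inter> A) \<le> 2 * CARD('g) * card \<P> + card W"
    using binary_tree_packing[OF *(5), of \<gamma>] by blast
  have cS: "card (S \<inter> A) = card (S' \<inter> A) + 1"
    using * binary_tree_basics(1)[OF *(5)] by simp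
  have pos: "CARD('g) \<ge> 1" by (simp add: Suc_leI)
  show ?thesis
  proof (cases "\<exists>g\<in>W. dir_label G \<gamma> e v + g = 0")
    case True
    then obtain g where g: "reaches_with_weight G \<gamma> A R v g" "dir_label G \<gamma> e v + g = 0"
      using IH by blast
    obtain Q where Q: "is_zero_A_path G \<gamma> A Q" "set (gwalk_verts Q) \<subseteq> insert b R"
      using zero_A_path_if_weight_cancels[OF g(1) *(4,2,1) _ g(2)] IH(1) *(3) by blast
    have "U \<inter> insert b R = {}" using IH * by blast
    note U = zero_packing_Un[OF IH(3) zero_packing_single[OF Q] this]
    have "zero_packing G \<gamma> A S (\<P> \<union> {Q})"
      using zero_packing_mono[OF U(1)] IH(1) * by auto
    moreover have "card (S \<inter> A) \<le> 3 * CARD('g) * card (\<P> \<union> {Q})"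
    proof -
      have "card W \<le> CARD('g)" by (simp add: card_mono)
      then have "card (S \<inter> A) \<le> 2 * (CARD('g) * card \<P>) + CARD('g) + 1"
        using IH(5) cS by (simp add: mult.assoc)
      also have "\<dots> \<le> 3 * (CARD('g) * card \<P>) + 3 * CARD('g)"
        using pos by linarith
      also have "\<dots> = 3 * CARD('g) * card (\<P> \<union> {Q})"
        unfolding U(2) by (simp add: algebra_simps)
      finally show ?thesis .
    qed
    ultimately show ?thesis by blast
  next
    case False
    \<comment> \<open>The weight that would cancel the label of the edge at \<open>b\<close> is
      missing from \<open>W\<close>.\<close>
    then have "- dir_label G \<gamma> e v \<notin> W" by force
    then have "W \<subset> UNIV" by blast
    then have W: "card W < CARD('g)" by (simp add: psubset_card_mono)
    show ?thesis
    \<comment> \<open>Without greedy paths there are at most \<open>CARD('g)\<close> leaves, and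
      \<open>P\<close> alone suffices. Otherwise the remaining \<open>CARD('g)\<close> leaves are
      charged to the greedy paths, raising the factor from 2 to 3.\<close>
    proof (cases "\<P> = {}")
      case True
      then have "card (S \<inter> A) \<le> 3 * CARD('g) * card {P}"
        using IH(5) cS W by simp
      then show ?thesis using zero_packing_single[OF assms(2,3)] by blast
    next
      case False
      moreover have "zero_packing G \<gamma> A S \<P>"
        using zero_packing_mono[OF IH(3)] IH(1) * by blast
      moreover have "card (S \<inter> A) \<le> 3 * CARD('g) * card \<P>"
      proof -
        have "card \<P> \<ge> 1"
          using False IH(3) by (simp add: zero_packing_def Suc_leI card_gt_0_iff)
        then have "CARD('g) * 1 \<le> CARD('g) * card \<P>" by (intro mult_le_mono2)
        moreover have "card (S \<inter> A) \<le> 2 * (CARD('g) * card \<P>) + CARD('g)"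
          using IH(5) cS W by (simp add: mult.assoc)
        ultimately show ?thesis by linarith
      qed
      ultimately show ?thesis by blast
    qed
  qed
qed

section \<open>Forests of such trees and their extension\<close>

text \<open>Only vertex sets are recorded: they determine the leaves, and the sets of leaves and
  branch vertices may be chosen later in any admissible way. Enlarging a tree preserves the zero
  path inside it.\<close>

definition zero_frame_forest ::
    "('a, 'b) pre_digraph \<Rightarrow> ('b \<Rightarrow> 'g::group_add) \<Rightarrow> 'a set \<Rightarrow> 'a set set \<Rightarrow> bool" where
  "zero_frame_forest G \<gamma> A F \<longleftrightarrow> disjoint F \<and>
     (\<forall>S\<in>F. (\<exists>X. frame_tree G A S X) \<and>
        (\<exists>P. is_zero_A_path G \<gamma> A P \<and> set (gwalk_verts P) \<subseteq> S))"

lemma del_verts_zero_A_path: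
  assumes "is_zero_A_path (del_verts G X) \<gamma> A P"
  shows "is_zero_A_path G \<gamma> A P" "set (gwalk_verts P) \<inter> X = {}"
proof -
  have steps: "steps_from G u p \<and> set (gwalk_verts (u, p)) \<inter> X = {}"
    if "steps_from (del_verts G X) u p" for u p
    using that
  proof (induction p arbitrary: u)
    case Nil
    then show ?case by (auto simp: del_verts_def gwalk_verts_def)
  next
    case (Cons s p)
    obtain e v where s: "s = (e, v)" by force
    from Cons show ?case
      by (auto simp: s del_verts_def induce_subgraph_def)
  qed
  have "dir_label (del_verts G X) \<gamma> = dir_label G \<gamma>"
    by (intro ext) (simp add: dir_label_def del_verts_def)
  then have wt: "gwalk_weight (del_verts G X) \<gamma> P = gwalk_weight G \<gamma> P"
    by (simp add: gwalk_weight_def)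
  show "is_zero_A_path G \<gamma> A P" "set (gwalk_verts P) \<inter> X = {}"
    using assms steps[of "fst P" "snd P"] wt
    by (auto simp: is_zero_A_path_def is_A_path_def is_gpath_def is_gwalk_def)
qed

lemma zero_frame_forest_extend:
  assumes "zero_frame_forest G \<gamma> A F" "finite A" "\<And>S. S \<in> F \<Longrightarrow> frame_tree G A S (X S)"
    and "is_zero_A_path G \<gamma> A P" "set (gwalk_verts P) \<inter> (\<Union>S\<in>F. X S) = {}"
  shows "\<exists>F'. zero_frame_forest G \<gamma> A F' \<and> card (\<Union>F' \<inter> A) > card (\<Union>F \<inter> A)"
proof -
  obtain a p where P: "P = (a, p)" by force
  have AP: "steps_from G a p" "distinct (gwalk_verts (a, p))" "p \<noteq> []"
    "set (gwalk_verts (a, p)) \<inter> A = {a, last (gwalk_verts (a, p))}"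
    using assms(4)
    by (auto simp: P is_zero_A_path_def is_A_path_def is_gpath_def is_gwalk_def gwalk_verts_def)
  have FA: "\<Union>F \<inter> A \<subseteq> (\<Union>S\<in>F. X S)"
    using frame_tree_basics(4)[OF assms(3)] by blast
  have aA: "a \<in> A" using AP(4) by blast
  have aF: "a \<notin> \<Union>F" using FA aA assms(5) by (auto simp: P gwalk_verts_def)
  \<comment> \<open>Covering the old trees and \<open>a\<close> suffices, since then
    \<open>a\<close> is an additional leaf.\<close>
  have "\<exists>F'. zero_frame_forest G \<gamma> A F' \<and> insert a (\<Union>F) \<subseteq> \<Union>F'"
  proof (cases "set (map snd p) \<inter> \<Union>F = {}")
    case True
    then have disj: "set (gwalk_verts P) \<inter> \<Union>F = {}" using aF by (auto simp: P gwalk_verts_def)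
    have "is_A_path G A P" using assms(4) by (simp add: is_zero_A_path_def)
    then have "zero_frame_forest G \<gamma> A (insert (set (gwalk_verts P)) F)"
      using assms(1,4) disj frame_tree_of_A_path[of G A P]
      unfolding zero_frame_forest_def disjoint_def by blast
    moreover have "a \<in> set (gwalk_verts P)" by (simp add: P gwalk_verts_def)
    ultimately show ?thesis by (intro exI[of _ "insert (set (gwalk_verts P)) F"]) auto
  next
    case False
    then have "\<exists>s\<in>set p. snd s \<in> \<Union>F" by auto
    \<comment> \<open>The step \<open>s\<close> is the first one to enter a tree; \<open>q\<close>
      is the part of the path before it.\<close>
    then obtain q s r where p: "p = q @ s # r" "snd s \<in> \<Union>F" "\<forall>t\<in>set q. snd t \<notin> \<Union>F"
      using split_list_first_prop[of p "\<lambda>s. snd s \<in> \<Union>F"] by blast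
    obtain e w where s: "s = (e, w)" by force
    obtain S where S: "S \<in> F" "w \<in> S" using p(2) s by auto
    have vs: "gwalk_verts (a, p) = a # map snd q @ w # map snd r"
      by (simp add: p s gwalk_verts_def)
    have st: "steps_from G a q" "joins G e w (last (gwalk_verts (a, q)))"
      using AP(1) unfolding p(1) s steps_from_append steps_from_Cons by (auto simp: joins_sym)
    have "a \<in> verts G" using st(1) by (cases q) auto
    then have leaf: "binary_tree G A a {a} {a}" using aA by (intro binary_tree.leaf)
    \<comment> \<open>The aim is that \<open>q\<close> avoids \<open>A\<close>: only the ends of the
      path lie in \<open>A\<close>, and the final one does not come before \<open>w\<close>.\<close>
    have "last (gwalk_verts (a, p)) = last (w # map snd r)" by (simp add: vs)
    then have "last (gwalk_verts (a, p)) \<in> set (w # map snd r)" by (metis last_in_set list.distinct(1))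
    moreover have "set (w # map snd r) \<inter> set (map snd q) = {}" and a_q: "a \<notin> set (map snd q)"
      using AP(2) unfolding vs by auto
    ultimately have "last (gwalk_verts (a, p)) \<notin> set (map snd q)" by (metis disjoint_iff)
    then have "set (map snd q) \<inter> {a, last (gwalk_verts (a, p))} = {}" using a_q by simp
    moreover have "set (map snd q) \<subseteq> set (gwalk_verts (a, p))" unfolding vs by auto
    ultimately have "set (map snd q) \<inter> A = {}"
      unfolding AP(4)[symmetric] by blast
    then have "set (map snd q) \<inter> ({a} \<union> A) = {}" using a_q by simp
    \<comment> \<open>The segment is a tree with the single leaf \<open>a\<close>, rooted at the
      vertex just before \<open>w\<close>, ready to become a child of \<open>w\<close>.\<close>
    then have T: "binary_tree G A (last (gwalk_verts (a, q))) ({a} \<union> set (map snd q)) {a}"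
      using AP(2) by (intro binary_tree_add_path[OF leaf st(1)]) (auto simp: vs)
    let ?T = "{a} \<union> set (map snd q)"
    have TF: "?T \<inter> \<Union>F = {}" using aF p(3) by auto
    have "w \<notin> X S" using assms(5) S by (auto simp: P vs)
    then obtain X' where "frame_tree G A (S \<union> ?T) X'"
      using frame_tree_graft[OF assms(3)[OF S(1)] T st(2)] S TF by blast
    moreover have "\<exists>P. is_zero_A_path G \<gamma> A P \<and> set (gwalk_verts P) \<subseteq> S \<union> ?T"
      using assms(1) S(1) unfolding zero_frame_forest_def by blast
    moreover have "disjoint (insert (S \<union> ?T) (F - {S}))"
    proof -
      have dF: "disjoint F" using assms(1) by (simp add: zero_frame_forest_def)
      have "disjnt (S \<union> ?T) B" if "B \<in> F - {S}" for B
      proof -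
        have "S \<inter> B = {}" using disjointD[OF dF S(1)] that by blast
        moreover have "?T \<inter> B = {}" using TF that by blast
        ultimately show ?thesis by (simp add: disjnt_def Int_Un_distrib2)
      qed
      moreover have "disjoint (F - {S})" using dF by (rule pairwise_subset) blast
      ultimately show ?thesis by (simp add: pairwise_insert disjnt_sym)
    qed
    ultimately have "zero_frame_forest G \<gamma> A (insert (S \<union> ?T) (F - {S}))"
      using assms(1) unfolding zero_frame_forest_def by blast
    then show ?thesis by (intro exI[of _ "insert (S \<union> ?T) (F - {S})"]) auto
  qed
  then obtain F' where F': "zero_frame_forest G \<gamma> A F'" "insert a (\<Union>F) \<subseteq> \<Union>F'" by blast
  have "\<Union>F \<inter> A \<subset> \<Union>F' \<inter> A" using F'(2) aA aF by blast
  then show ?thesis using F'(1) assms(2) psubset_card_mono[of "\<Union>F' \<inter> A"] by blast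
qed

section \<open>A forest with the most leaves, and the final count\<close>

theorem theorem2p3:
  fixes G :: "('a, 'b) pre_digraph"
    and \<gamma> :: "'b \<Rightarrow> 'g::{group_add, finite}"
    and A :: "'a set"
    and k :: nat
  assumes "fin_digraph G" and "A \<subseteq> verts G" and "k \<ge> 1"
  shows "(\<exists>\<P>. finite \<P> \<and> card \<P> = k \<and> (\<forall>P\<in>\<P>. is_zero_A_path G \<gamma> A P) \<and>
            pairwise (\<lambda>P Q. disjnt (set (gwalk_verts P)) (set (gwalk_verts Q))) \<P>)
       \<or> (\<exists>X\<subseteq>verts G.
            (card X < 6 * (k - 1) * CARD('g) \<or> k = 1 \<and> X = {}) \<and>
            \<not> (\<exists>P. is_zero_A_path (del_verts G X) \<gamma> A P))"
proof -
  have finV: "finite (verts G)" using assms(1) by (simp add: fin_digraph.finite_verts)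
  then have finA: "finite A" using assms(2) finite_subset by blast
  let ?m = "\<lambda>F. card (\<Union>F \<inter> A)"
  have "zero_frame_forest G \<gamma> A {}" by (simp add: zero_frame_forest_def)
  \<comment> \<open>The number of leaves is bounded by \<open>card A\<close>, so a maximum
    exists.\<close>
  moreover have "\<forall>F. zero_frame_forest G \<gamma> A F \<longrightarrow> ?m F < Suc (card A)"
    using finA by (simp add: card_mono less_Suc_eq_le)
  ultimately obtain F where F: "zero_frame_forest G \<gamma> A F"
    and max: "\<And>F'. zero_frame_forest G \<gamma> A F' \<Longrightarrow> ?m F' \<le> ?m F"
    using ex_has_greatest_nat[of "zero_frame_forest G \<gamma> A" "{}" ?m] by blast
  obtain X where X: "\<And>S. S \<in> F \<Longrightarrow> frame_tree G A S (X S)"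
    using F unfolding zero_frame_forest_def by metis
  have "\<exists>\<P>. zero_packing G \<gamma> A S \<P> \<and> \<P> \<noteq> {} \<and> card (S \<inter> A) \<le> 3 * CARD('g) * card \<P>"
    if "S \<in> F" for S
    using F frame_tree_packing[OF X[OF that]] that unfolding zero_frame_forest_def by blast
  then obtain \<P> where \<P>: "\<And>S. S \<in> F \<Longrightarrow> zero_packing G \<gamma> A S (\<P> S)"
    "\<And>S. S \<in> F \<Longrightarrow> \<P> S \<noteq> {}" "\<And>S. S \<in> F \<Longrightarrow> card (S \<inter> A) \<le> 3 * CARD('g) * card (\<P> S)"
    by metis
  have "F \<subseteq> Pow (verts G)" using frame_tree_basics(2)[OF X] by blast
  then have finF: "finite F" using finV finite_subset by blast
  have disjF: "disjoint_family_on (\<lambda>S. S) F"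
    using F by (auto simp: zero_frame_forest_def disjoint_def disjoint_family_on_def)
  note pack = zero_packing_UN[OF finF disjF \<P>(1)]
  show ?thesis
  proof (cases "(\<Sum>S\<in>F. card (\<P> S)) \<ge> k")
    case True
    then obtain \<Q> where \<Q>: "\<Q> \<subseteq> (\<Union>S\<in>F. \<P> S)" "card \<Q> = k" "finite \<Q>"
      using pack(2) obtain_subset_with_card_n by metis
    then have "\<forall>P\<in>\<Q>. is_zero_A_path G \<gamma> A P"
      "pairwise (\<lambda>P Q. disjnt (set (gwalk_verts P)) (set (gwalk_verts Q))) \<Q>"
      using pack(1) unfolding zero_packing_def by (blast intro: pairwise_subset)+
    then show ?thesis using \<Q> by blast
  next
    case False
    let ?X = "\<Union>S\<in>F. X S"
    have "?X \<subseteq> verts G" using frame_tree_basics(2,3)[OF X] by blast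
    moreover have "\<not> (\<exists>P. is_zero_A_path (del_verts G ?X) \<gamma> A P)"
    proof
      assume "\<exists>P. is_zero_A_path (del_verts G ?X) \<gamma> A P"
      then obtain P where "is_zero_A_path (del_verts G ?X) \<gamma> A P" by blast
      from zero_frame_forest_extend[OF F finA X del_verts_zero_A_path[OF this]] max
      show False by (meson not_less)
    qed
    moreover have "card ?X < 6 * (k - 1) * CARD('g) \<or> k = 1 \<and> ?X = {}"
    \<comment> \<open>Without trees \<open>?X\<close> is empty. For \<open>k = 1\<close> the strict
      bound would then read 0 < 0, which is why the second alternative is there.\<close>
    proof (cases "F = {}")
      case True
      then show ?thesis using assms(3) by (cases "k = 1") auto
    next
      case F_ne: False
      have "card ?X \<le> (\<Sum>S\<in>F. card (X S))" using finF by (rule card_UN_le)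
      also have "\<dots> < (\<Sum>S\<in>F. 6 * CARD('g) * card (\<P> S))"
      proof (rule sum_strict_mono[OF finF F_ne])
        fix S assume "S \<in> F"
        \<comment> \<open>With l leaves in \<open>S\<close>, \<open>card (X S)\<close> is 2l - 2,
          which is less than 2l; this is where strictness comes from.\<close>
        then show "card (X S) < 6 * CARD('g) * card (\<P> S)"
          using frame_tree_basics(5)[OF X] \<P>(3) by fastforce
      qed
      also have "\<dots> = 6 * CARD('g) * (\<Sum>S\<in>F. card (\<P> S))" by (simp add: sum_distrib_left)
      also have "\<dots> \<le> 6 * CARD('g) * (k - 1)" using False by (intro mult_le_mono2) simp
      finally show ?thesis by (simp add: mult_ac)
    qed
    ultimately show ?thesis by (intro disjI2 exI[of _ ?X]) blast
  qed
qed

end
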